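(* Let $\mathcal{D}=(V,E,F)$ be an infinite, locally finite cellular decomposition of a surface $S$, with intersection angle $\Theta\in(0,\frac{\pi}{2}]^E$. Let $\hat T=\{\hat T_i\}_{v_i\in V}$ be a family of real numbers (write $\hat T_v=\hat T_i$ for $v=v_i$) such that $$\hat T_v>0\quad\text{for all } v\in V,$$ and $$\sum_{v\in U}\hat T_v<2\sum_{e\in E(U)}\Theta(e)\quad\text{for all nonempty } U\subset V,$$ where $U$ may be finite or infinite. Then for any initial value $r(0)\in(0,\frac{\pi}{2})^V$ there exists a solution $r(t)\in(0,\frac{\pi}{2})^V$, defined for $t\in[0,\infty)$ and with the given initial value $r(0)$, to the flow $$\frac{\mathrm{d} r_i}{\mathrm{d} t}=\frac{T_i(r(t))-\hat T_i}{2}\,\sin(2r_i),\qquad \forall v_i\in V.$$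
   Context: A cellular decomposition $\mathcal{D}=(V,E,F)$ of a surface $S$ has vertex set $V$, edge set $E$ and face set $F$. It is infinite, with vertex set $V=\{v_i\}_{i=1}^\infty$, and locally finite: $\deg(v)<+\infty$ for every $v\in V$. We write $v<e$ if the vertex $v$ is incident to the edge $e$, and $e=[v_i,v_j]$ for an edge with endpoints $v_i,v_j$. A circle pattern metric is a function $r:V\to(0,\frac{\pi}{2})$, $r_i=r(v_i)$; an intersection angle is a function $\Theta:E\to(0,\frac{\pi}{2}]$. For $U\subset V$, $E(U)$ is the set of edges incident to at least one vertex of $U$. Given $(\mathcal{D},r,\Theta)$, for each edge $e=[v_i,v_j]$ let $Q_e$ be the spherical quadrilateral (on the unit sphere) with vertices $v_i,A,v_j,B$ such that $\angle v_iAv_j=\angle v_iBv_j=\pi-\Theta(e)$, $|v_iA|=|v_iB|=r_i$, $|v_jA|=|v_jB|=r_j$; it is unique up to isometry. Let $\Theta(e,v_i)=\angle Av_iB$ be its angle at $v_i$. The cone angle at $v_i$ is $\alpha_i=\sum_{e:\,v_i<e}\Theta(e,v_i)$, and the total geodesic curvature of the circle centered at $v_i$ with radius $r_i$ is $T_i=T_i(r)=\alpha_i\cos r_i$. *)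

theory Defs
  imports "HOL-Analysis.Analysis"
begin

text \<open>
  A surface is a topological 2-manifold without boundary; it is neither required to be
  compact nor to be connected or orientable.
\<close>

definition surface :: "'a topology \<Rightarrow> bool" where
  "surface S \<longleftrightarrow>
     Hausdorff_space S \<and> second_countable S \<and>
     (\<forall>x\<in>topspace S. \<exists>U. openin S U \<and> x \<in> U \<and>
        (\<exists>W :: (real^2) set. open W \<and> subtopology S U homeomorphic_space top_of_set W))"

text \<open>
  Vertices are points of the surface, edges and faces are open cells, i.e. sets of points.
  So two different edges may have the same endpoints, and the two endpoints of an edge may
  coincide.
\<close>

definition edge_char_map ::
    "'a topology \<Rightarrow> 'a set \<Rightarrow> 'a set \<Rightarrow> (real \<Rightarrow> 'a) \<Rightarrow> bool" where
  "edge_char_map S V e \<phi> \<longleftrightarrow>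
     continuous_map (top_of_set {0..1}) S \<phi> \<and>
     homeomorphic_map (top_of_set {0<..<1}) (subtopology S e) \<phi> \<and>
     \<phi> ` {0, 1} \<subseteq> V"

definition face_char_map ::
    "'a topology \<Rightarrow> 'a set \<Rightarrow> 'a set set \<Rightarrow> 'a set \<Rightarrow> (real^2 \<Rightarrow> 'a) \<Rightarrow> bool" where
  "face_char_map S V E f \<phi> \<longleftrightarrow>
     continuous_map (top_of_set (cball 0 1)) S \<phi> \<and>
     homeomorphic_map (top_of_set (ball 0 1)) (subtopology S f) \<phi> \<and>
     (\<exists>V' E'. finite V' \<and> V' \<subseteq> V \<and> finite E' \<and> E' \<subseteq> E \<and> \<phi> ` sphere 0 1 \<subseteq> V' \<union> \<Union>E')"

definition cells :: "'a set \<Rightarrow> 'a set set \<Rightarrow> 'a set set \<Rightarrow> 'a set set" where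
  "cells V E F = (\<lambda>v. {v}) ` V \<union> E \<union> F"

text \<open>
  A cellular decomposition is a structure of a 2-dimensional CW complex on the surface.
  The last conjunct is the weak topology.
\<close>

definition cellular_decomposition ::
    "'a topology \<Rightarrow> 'a set \<Rightarrow> 'a set set \<Rightarrow> 'a set set \<Rightarrow> bool" where
  "cellular_decomposition S V E F \<longleftrightarrow>
     partition_on (topspace S) (cells V E F) \<and>
     (\<forall>e\<in>E. \<exists>\<phi>. edge_char_map S V e \<phi>) \<and>
     (\<forall>f\<in>F. \<exists>\<phi>. face_char_map S V E f \<phi>) \<and>
     (\<forall>C\<subseteq>topspace S.
        (\<forall>c\<in>cells V E F. closedin S (C \<inter> S closure_of c)) \<longrightarrow> closedin S C)"

definition incident :: "'a topology \<Rightarrow> 'a \<Rightarrow> 'a set \<Rightarrow> bool" where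
  "incident S v e \<longleftrightarrow> v \<in> S closure_of e"

definition edges_at :: "'a topology \<Rightarrow> 'a set set \<Rightarrow> 'a \<Rightarrow> 'a set set" where
  "edges_at S E v = {e \<in> E. incident S v e}"

definition edges_of :: "'a topology \<Rightarrow> 'a set set \<Rightarrow> 'a set \<Rightarrow> 'a set set" where
  "edges_of S E U = {e \<in> E. \<exists>v\<in>U. incident S v e}"

definition locally_finite_decomposition :: "'a topology \<Rightarrow> 'a set \<Rightarrow> 'a set set \<Rightarrow> bool" where
  "locally_finite_decomposition S V E \<longleftrightarrow> (\<forall>v\<in>V. finite (edges_at S E v))"

text \<open>
  An open 1-cell together with its endpoints is its closure. If \<open>e\<close> is a loop at \<open>v\<close>, then
  \<open>endpoints S e = {v} = {v, v}\<close>, so that \<open>other_end S e v = v\<close>.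
\<close>

definition endpoints :: "'a topology \<Rightarrow> 'a set \<Rightarrow> 'a set" where
  "endpoints S e = S closure_of e - e"

definition other_end :: "'a topology \<Rightarrow> 'a set \<Rightarrow> 'a \<Rightarrow> 'a" where
  "other_end S e v = (THE w. endpoints S e = {v, w})"

definition sph_dist :: "real^3 \<Rightarrow> real^3 \<Rightarrow> real" where
  "sph_dist P Q = arccos (P \<bullet> Q)"

definition vec_angle :: "real^3 \<Rightarrow> real^3 \<Rightarrow> real" where
  "vec_angle u w = arccos (u \<bullet> w / (norm u * norm w))"

text \<open>
  For \<open>P\<close> and \<open>A\<close> on the unit sphere, \<open>A - (A \<bullet> P) *\<^sub>R P\<close> is tangent to the sphere at \<open>P\<close>
  and points in the direction of the geodesic from \<open>P\<close> to \<open>A\<close>. So \<open>sph_angle A P B\<close> is the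
  angle at \<open>P\<close> between the geodesics from \<open>P\<close> to \<open>A\<close> and to \<open>B\<close>.
\<close>

definition sph_angle :: "real^3 \<Rightarrow> real^3 \<Rightarrow> real^3 \<Rightarrow> real" where
  "sph_angle A P B = vec_angle (A - (A \<bullet> P) *\<^sub>R P) (B - (B \<bullet> P) *\<^sub>R P)"

text \<open>
  \<open>P\<close> and \<open>Q\<close> stand for the two centres, \<open>A\<close> and \<open>B\<close> for the two inter
  circles. The distances and angles determine \<open>A\<close> and \<open>B\<close> up to reflection in the great circle
  through \<open>P\<close> and \<open>Q\<close>; distinctness of the four vertices rules out the degenerate case
  \<open>A = B\<close>, so that \<open>A\<close> and \<open>B\<close> lie on different sides of that great circle.
\<close>

definition edge_quadrilateral ::
    "real \<Rightarrow> real \<Rightarrow> real \<Rightarrow> real^3 \<Rightarrow> real^3 \<Rightarrow> real^3 \<Rightarrow> real^3 \<Rightarrow> bool" where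
  "edge_quadrilateral ri rj \<theta> P A Q B \<longleftrightarrow>
     {P, A, Q, B} \<subseteq> sphere 0 1 \<and> distinct [P, A, Q, B] \<and>
     sph_angle P A Q = pi - \<theta> \<and> sph_angle P B Q = pi - \<theta> \<and>
     sph_dist P A = ri \<and> sph_dist P B = ri \<and>
     sph_dist Q A = rj \<and> sph_dist Q B = rj"

definition quadrilateral_angle :: "real \<Rightarrow> real \<Rightarrow> real \<Rightarrow> real" where
  "quadrilateral_angle ri rj \<theta> =
     (THE \<alpha>. \<exists>P A Q B. edge_quadrilateral ri rj \<theta> P A Q B \<and> \<alpha> = sph_angle A P B)"

definition intersection_angle :: "'a set set \<Rightarrow> ('a set \<Rightarrow> real) \<Rightarrow> bool" where
  "intersection_angle E \<Theta> \<longleftrightarrow> (\<forall>e\<in>E. 0 < \<Theta> e \<and> \<Theta> e \<le> pi / 2)"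

definition circle_pattern_metric :: "'a set \<Rightarrow> ('a \<Rightarrow> real) \<Rightarrow> bool" where
  "circle_pattern_metric V r \<longleftrightarrow> (\<forall>v\<in>V. 0 < r v \<and> r v < pi / 2)"

definition angle_at ::
    "'a topology \<Rightarrow> ('a set \<Rightarrow> real) \<Rightarrow> ('a \<Rightarrow> real) \<Rightarrow> 'a set \<Rightarrow> 'a \<Rightarrow> real" where
  "angle_at S \<Theta> r e v = quadrilateral_angle (r v) (r (other_end S e v)) (\<Theta> e)"

text \<open>
  The sum ranges over the set of edges incident to \<open>v\<close>; in particular a loop at \<open>v\<close>
  contributes one summand.
\<close>

definition cone_angle ::
    "'a topology \<Rightarrow> 'a set set \<Rightarrow> ('a set \<Rightarrow> real) \<Rightarrow> ('a \<Rightarrow> real) \<Rightarrow> 'a \<Rightarrow> real" where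
  "cone_angle S E \<Theta> r v = (\<Sum>e\<in>edges_at S E v. angle_at S \<Theta> r e v)"

definition total_geodesic_curvature ::
    "'a topology \<Rightarrow> 'a set set \<Rightarrow> ('a set \<Rightarrow> real) \<Rightarrow> ('a \<Rightarrow> real) \<Rightarrow> 'a \<Rightarrow> real" where
  "total_geodesic_curvature S E \<Theta> r v = cone_angle S E \<Theta> r v * cos (r v)"

text \<open>
  The derivative is taken within \<open>[0, \<infinity>)\<close>, so it is one-sided at time \<open>0\<close>.
\<close>

definition flow_solution ::
    "'a topology \<Rightarrow> 'a set \<Rightarrow> 'a set set \<Rightarrow> ('a set \<Rightarrow> real) \<Rightarrow> ('a \<Rightarrow> real) \<Rightarrow>
      (real \<Rightarrow> 'a \<Rightarrow> real) \<Rightarrow> bool" where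
  "flow_solution S V E \<Theta> That r \<longleftrightarrow>
     (\<forall>t\<ge>0. circle_pattern_metric V (r t) \<and>
        (\<forall>v\<in>V. ((\<lambda>s. r s v) has_real_derivative
           (total_geodesic_curvature S E \<Theta> (r t) v - That v) / 2 * sin (2 * r t v))
             (at t within {0..})))"

end

theory Submission
  imports Defs
begin

text \<open>
  In the coordinates \<open>x = ln (tan r)\<close> the flow reads \<open>x' = T - That\<close> on a product of
  lines. By local finiteness each component of the right-hand side is
  continuous for the product topology, and it is bounded because every angle of a quadrilateral
  lies in \<open>[0, pi]\<close>. Solutions of such a system exist for all time by a Peano argument. To see
  that the angle depends continuously on the radii, express its cosine by them: if \<open>A \<noteq> B\<close>
  are the intersection points, then \<open>P\<close>, \<open>Q\<close> and \<open>A + B\<close> are orthogonal to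
  \<open>A - B\<close>, so their Gram determinant vanishes, and this determines \<open>A \<bullet> B\<close>.
\<close>

section \<open>Pointwise convergence and compactness in product spaces\<close>

lemma tendsto_fun_iff:
  fixes f :: "'c \<Rightarrow> 'a \<Rightarrow> 'b::topological_space"
  shows "(f \<longlongrightarrow> l) F \<longleftrightarrow> (\<forall>i. ((\<lambda>c. f c i) \<longlongrightarrow> l i) F)"
  using limitin_componentwise[of "\<lambda>_. euclidean" UNIV f l F]
  by (simp add: euclidean_product_topology)

lemma compact_Pi_UNIV:
  fixes K :: "'a \<Rightarrow> 'b::topological_space set"
  assumes "\<And>i. compact (K i)"
  shows "compact (Pi UNIV K)"
proof -
  have "compactin (product_topology (\<lambda>_. euclidean) UNIV) (PiE UNIV K)"
    unfolding compactin_PiE using assms by simp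
  then show ?thesis
    by (simp add: euclidean_product_topology PiE_UNIV_domain)
qed

section \<open>Euler approximations and a Peano theorem on a product of lines\<close>

primrec euler :: "('a \<Rightarrow> ('a \<Rightarrow> real) \<Rightarrow> real) \<Rightarrow> ('a \<Rightarrow> real) \<Rightarrow> real \<Rightarrow> nat \<Rightarrow> 'a \<Rightarrow> real" where
  "euler G x0 h 0 = x0"
| "euler G x0 h (Suc k) = (\<lambda>v. euler G x0 h k v + h * G v (euler G x0 h k))"

text \<open>A step function in place of the usual polygon; for bounded \<open>G\<close> its jumps
  are of order \<open>h\<close> and vanish in the limit. For \<open>h > 0\<close> the truncation by
  \<open>nat\<close> makes the path rest at \<open>x0\<close> for \<open>t \<le> 0\<close>.\<close>

definition euler_path :: "('a \<Rightarrow> ('a \<Rightarrow> real) \<Rightarrow> real) \<Rightarrow> ('a \<Rightarrow> real) \<Rightarrow> real \<Rightarrow> real \<Rightarrow> 'a \<Rightarrow> real" where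
  "euler_path G x0 h t = euler G x0 h (nat \<lfloor>t / h\<rfloor>)"

text \<open>Each step misses \<open>h * c\<close> by at most \<open>h * \<epsilon>\<close>, and
  these errors add up. With \<open>c = 0\<close> this becomes a Lipschitz bound; with
  \<open>c\<close> the expected slope it controls difference quotients.\<close>

lemma euler_increment:
  assumes "h \<ge> 0" "j \<le> k"
    and "\<And>i. j \<le> i \<Longrightarrow> i < k \<Longrightarrow> \<bar>G v (euler G x0 h i) - c\<bar> \<le> \<epsilon>"
  shows "\<bar>euler G x0 h k v - euler G x0 h j v - (real k - real j) * h * c\<bar> \<le> (real k - real j) * h * \<epsilon>"
  using assms(2,3)
proof (induction k rule: dec_induct)
  case base
  then show ?case by simp
next
  case (step k)
  let ?d = "G v (euler G x0 h k) - c"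
  have "\<bar>euler G x0 h k v - euler G x0 h j v - (real k - real j) * h * c\<bar> \<le> (real k - real j) * h * \<epsilon>"
    using step by simp
  moreover have "\<bar>h * ?d\<bar> \<le> h * \<epsilon>"
    using step.prems[of k] step.hyps assms(1) by (simp add: abs_mult mult_left_mono)
  moreover have "euler G x0 h (Suc k) v - euler G x0 h j v - (real (Suc k) - real j) * h * c
      = (euler G x0 h k v - euler G x0 h j v - (real k - real j) * h * c) + h * ?d"
    by (simp add: algebra_simps)
  moreover have "(real (Suc k) - real j) * h * \<epsilon> = (real k - real j) * h * \<epsilon> + h * \<epsilon>"
    by (simp add: algebra_simps)
  ultimately show ?case by linarith
qed

text \<open>The last node up to \<open>s\<close> may precede \<open>s\<close> by almost
  \<open>h\<close>, so \<open>close\<close> reaches back to \<open>s - h\<close>. The time between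
  the two nodes differs from \<open>t - s\<close> by at most \<open>h\<close>, which costs the terms
  \<open>h * \<epsilon>\<close> and \<open>h * \<bar>c\<bar>\<close>.\<close>

lemma euler_path_increment:
  assumes h: "h > 0" and st: "0 \<le> s" "s \<le> t"
    and close: "\<And>\<tau>. 0 \<le> \<tau> \<Longrightarrow> s - h < \<tau> \<Longrightarrow> \<tau> \<le> t \<Longrightarrow> \<bar>G v (euler_path G x0 h \<tau>) - c\<bar> \<le> \<epsilon>"
  shows "\<bar>euler_path G x0 h t v - euler_path G x0 h s v - (t - s) * c\<bar> \<le> (t - s + h) * \<epsilon> + h * \<bar>c\<bar>"
proof -
  define j k where "j = nat \<lfloor>s / h\<rfloor>" and "k = nat \<lfloor>t / h\<rfloor>"
  have "0 \<le> s / h" "s / h \<le> t / h"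
    using st h by (simp_all add: divide_right_mono)
  then have jk: "j \<le> k" and j: "real j \<le> s / h" "s / h < real j + 1" and k: "real k \<le> t / h" "t / h < real k + 1"
    unfolding j_def k_def by (auto intro!: nat_mono floor_mono)
  have jh: "real j * h \<le> s" "s < real j * h + h" and kh: "real k * h \<le> t" "t < real k * h + h"
    using j k h by (simp_all add: field_simps)
  have len: "\<bar>(real k - real j) * h - (t - s)\<bar> \<le> h" "(real k - real j) * h \<le> t - s + h"
    using jh kh by (simp_all add: algebra_simps abs_le_iff)
  have path: "euler_path G x0 h (real i * h) = euler G x0 h i" for i
    using h by (simp add: euler_path_def)
  have "\<bar>euler G x0 h k v - euler G x0 h j v - (real k - real j) * h * c\<bar> \<le> (real k - real j) * h * \<epsilon>"
  proof (rule euler_increment)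
    fix i assume i: "j \<le> i" "i < k"
    have "real j * h \<le> real i * h" "real i * h \<le> real k * h"
      using i h by (auto intro!: mult_right_mono)
    then have "\<bar>G v (euler_path G x0 h (real i * h)) - c\<bar> \<le> \<epsilon>"
      using jh kh h by (intro close) (simp, linarith+)
    then show "\<bar>G v (euler G x0 h i) - c\<bar> \<le> \<epsilon>"
      by (simp add: path)
  qed (use h jk in auto)
  moreover have "(real k - real j) * h * \<epsilon> \<le> (t - s + h) * \<epsilon>"
  proof -
    have "\<bar>G v (euler_path G x0 h s) - c\<bar> \<le> \<epsilon>"
      using st h by (intro close) auto
    then have "\<epsilon> \<ge> 0" by linarith
    with len show ?thesis by (intro mult_right_mono)
  qed
  moreover have "\<bar>(real k - real j) * h * c - (t - s) * c\<bar> \<le> h * \<bar>c\<bar>"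
    using mult_right_mono[OF len(1), of "\<bar>c\<bar>"] by (simp add: abs_mult[symmetric] algebra_simps)
  ultimately show ?thesis
    unfolding euler_path_def j_def[symmetric] k_def[symmetric] by linarith
qed

text \<open>
  By Tychonoff's theorem the Euler paths have a pointwise cluster point. The filter \<open>A\<close> along
  which they converge to it replaces a subsequence, so the index type may be uncountable. Each
  component is Lipschitz up to the step size, uniformly in the step, so the convergence passes
  to the difference quotients.
\<close>

lemma peano_product:
  fixes G :: "'a \<Rightarrow> ('a \<Rightarrow> real) \<Rightarrow> real"
  assumes cont: "\<And>v. continuous_on UNIV (G v)"
    and bound: "\<And>v x. \<bar>G v x\<bar> \<le> M v"
  obtains X where "X 0 = x0"
    and "\<And>v t. t \<ge> 0 \<Longrightarrow> ((\<lambda>s. X s v) has_real_derivative G v (X t)) (at t within {0..})"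
proof -
  define h where "h n = inverse (real (Suc n))" for n
  have h: "h n > 0" "h n \<le> 1" for n
    by (simp_all add: h_def inverse_le_1_iff)
  have h0: "h \<longlonglongrightarrow> 0"
    unfolding h_def by (rule LIMSEQ_inverse_real_of_nat)
  define P where "P n = euler_path G x0 (h n)" for n
  have M0: "M v \<ge> 0" for v
    using bound[of v x0] by linarith
  have lip: "\<bar>P n t v - P n s v\<bar> \<le> (\<bar>t - s\<bar> + h n) * M v" if "0 \<le> s" "0 \<le> t" for n s t v
  proof (cases "s \<le> t")
    case True
    then show ?thesis
      using euler_path_increment[of "h n" s t G v x0 0 "M v"] that bound h by (simp add: P_def)
  next
    case False
    then show ?thesis
      using euler_path_increment[of "h n" t s G v x0 0 "M v"] that bound h by (simp add: P_def abs_minus_commute)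
  qed
  have P0: "P n t = x0" if "t \<le> 0" for n t
    using that h[of n] by (simp add: P_def euler_path_def divide_nonpos_pos)
  \<comment> \<open>Coordinates are pairs of a time and a component, so one application of
    Tychonoff's theorem treats all times together. The \<open>+ 1\<close> absorbs the step size,
    since \<open>h n \<le> 1\<close>.\<close>
  define K where "K = (\<lambda>(t, v). cball (x0 v) ((\<bar>t\<bar> + 1) * M v))"
  define Q where "Q n = (\<lambda>(t, v). P n t v)" for n
  have "compact (Pi UNIV K)"
    by (rule compact_Pi_UNIV) (simp add: K_def split: prod.split)
  moreover have "Q n \<in> Pi UNIV K" for n
  proof (clarsimp simp: K_def Q_def dist_real_def)
    fix t v
    show "\<bar>x0 v - P n t v\<bar> \<le> (\<bar>t\<bar> + 1) * M v"
    proof (cases "t \<le> 0")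
      case True
      then show ?thesis using M0[of v] by (simp add: P0)
    next
      case False
      then have "\<bar>P n t v - P n 0 v\<bar> \<le> (t + h n) * M v"
        using lip[of 0 t n v] by simp
      also have "\<dots> \<le> (\<bar>t\<bar> + 1) * M v"
        using False h[of n] M0[of v] by (intro mult_right_mono) auto
      finally show ?thesis by (simp add: P0 abs_minus_commute)
    qed
  qed
  then have "\<forall>\<^sub>F x in filtermap Q sequentially. x \<in> Pi UNIV K"
    by (simp add: eventually_filtermap)
  moreover have "filtermap Q sequentially \<noteq> bot"
    by (simp add: filtermap_bot_iff)
  ultimately obtain q where q: "inf (nhds q) (filtermap Q sequentially) \<noteq> bot"
    unfolding compact_filter by blast
  define A where "A = inf (filtercomap Q (nhds q)) sequentially"
  have A: "A \<noteq> bot" "A \<le> sequentially"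
  proof -
    \<comment> \<open>If \<open>A\<close> were trivial, some neighbourhood of \<open>q\<close> would
      contain \<open>Q n\<close> for no large \<open>n\<close>, although \<open>q\<close> is a
      cluster point.\<close>
    show "A \<noteq> bot"
    proof
      assume "A = bot"
      then obtain R N where R: "eventually R (nhds q)" and N: "eventually N sequentially"
        and RN: "\<And>n. R (Q n) \<Longrightarrow> N n \<Longrightarrow> False"
        unfolding A_def trivial_limit_def eventually_inf eventually_filtercomap by blast
      have "\<forall>\<^sub>F x in filtermap Q sequentially. \<not> R x"
        unfolding eventually_filtermap using N by eventually_elim (use RN in blast)
      with R q show False
        unfolding trivial_limit_def eventually_inf by blast
    qed
  qed (simp add: A_def)
  define X where "X t v = q (t, v)" for t v
  have "(Q \<longlongrightarrow> q) A"
    unfolding A_def using filterlim_filtercomap by (rule filterlim_mono) auto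
  then have PX: "((\<lambda>n. P n t v) \<longlongrightarrow> X t v) A" for t v
    unfolding tendsto_fun_iff by (auto simp: Q_def X_def dest: spec[of _ "(t, v)"])
  have hA: "(h \<longlongrightarrow> 0) A"
    using h0 A(2) by (rule tendsto_mono[rotated])
  have "X 0 = x0"
  proof
    fix v show "X 0 v = x0 v"
      using tendsto_unique[OF A(1) PX[of 0 v], of "x0 v"] by (simp add: P0)
  qed
  moreover have "((\<lambda>s. X s v) has_real_derivative G v (X t)) (at t within {0..})" if t: "t \<ge> 0" for v t
  proof -
    \<comment> \<open>Along \<open>B\<close> the index runs through \<open>A\<close> while the time
      tends to \<open>t\<close> within \<open>[0, \<infinity>)\<close>. The limit must be joint
      because an increment of \<open>P n\<close> involves \<open>G\<close> at all times of an
      interval for the same \<open>n\<close>.\<close>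
    define B where "B = A \<times>\<^sub>F (inf (nhds t) (principal {0..}))"
    have fstB: "filterlim fst A B" and sndB: "(snd \<longlongrightarrow> t) B" and posB: "\<forall>\<^sub>F p in B. snd p \<ge> 0"
    proof -
      show "filterlim fst A B"
        unfolding B_def by (rule filterlim_fst)
      have "filterlim snd (inf (nhds t) (principal {0..})) B"
        unfolding B_def by (rule filterlim_snd)
      then show "(snd \<longlongrightarrow> t) B" "\<forall>\<^sub>F p in B. snd p \<ge> 0"
        by (auto simp: filterlim_inf filterlim_principal)
    qed
    \<comment> \<open>Compare \<open>P n s\<close> with \<open>P n t\<close> by the Lipschitz bound
      and \<open>P n t\<close> with \<open>X t\<close> by pointwise convergence; both errors vanish
      along \<open>B\<close>.\<close>
    have "((\<lambda>(n, s). P n s) \<longlongrightarrow> X t) B"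
      unfolding tendsto_fun_iff
    proof
      fix w
      have "((\<lambda>p. (\<bar>snd p - t\<bar> + h (fst p)) * M w + \<bar>P (fst p) t w - X t w\<bar>)
          \<longlongrightarrow> (\<bar>t - t\<bar> + 0) * M w + \<bar>X t w - X t w\<bar>) B"
        by (intro tendsto_intros sndB filterlim_compose[OF hA fstB] filterlim_compose[OF PX fstB])
      then have lim: "((\<lambda>p. (\<bar>snd p - t\<bar> + h (fst p)) * M w + \<bar>P (fst p) t w - X t w\<bar>) \<longlongrightarrow> 0) B"
        by simp
      have "\<forall>\<^sub>F p in B. norm (P (fst p) (snd p) w - X t w)
          \<le> (\<bar>snd p - t\<bar> + h (fst p)) * M w + \<bar>P (fst p) t w - X t w\<bar>"
        using posB
      proof eventually_elim
        case (elim p)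
        show ?case using lip[OF t elim, of "fst p" w] by simp
      qed
      from Lim_null_comparison[OF this lim]
      show "((\<lambda>c. (case c of (n, s) \<Rightarrow> P n s) w) \<longlongrightarrow> X t w) B"
        by (simp add: LIM_zero_iff case_prod_unfold)
    qed
    then have "((\<lambda>p. P (fst p) (snd p)) \<longlongrightarrow> X t) B"
      by (simp add: case_prod_unfold)
    moreover have "(G v \<longlongrightarrow> G v (X t)) (at (X t))"
      using cont[of v] by (simp add: continuous_on_def)
    ultimately have GB: "((\<lambda>p. G v (P (fst p) (snd p))) \<longlongrightarrow> G v (X t)) B"
      by (rule tendsto_compose[rotated])
    define c where "c = G v (X t)"
    have "\<exists>d>0. \<forall>y\<in>{0..}. norm (y - t) < d \<longrightarrow>
        norm (X y v - X t v - c * (y - t)) \<le> \<epsilon> * norm (y - t)" if "\<epsilon> > 0" for \<epsilon>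
    proof -
      have "\<forall>\<^sub>F p in B. \<bar>G v (P (fst p) (snd p)) - c\<bar> < \<epsilon>"
        using tendstoD[OF GB \<open>\<epsilon> > 0\<close>] by (simp add: c_def dist_real_def)
      then obtain Pa Pb where Pa: "eventually Pa A" and Pb: "eventually Pb (inf (nhds t) (principal {0..}))"
        and Pab: "\<And>n s. Pa n \<Longrightarrow> Pb s \<Longrightarrow> \<bar>G v (P n s) - c\<bar> < \<epsilon>"
        unfolding B_def eventually_prod_filter by auto
      from Pb obtain d where d: "d > 0" "\<And>s. \<bar>s - t\<bar> < d \<Longrightarrow> 0 \<le> s \<Longrightarrow> Pb s"
        unfolding eventually_inf_principal eventually_nhds_metric by (auto simp: dist_real_def)
      \<comment> \<open>Half of \<open>d\<close> is kept in reserve: once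
        \<open>h n < d / 2\<close>, the enlarged time window of \<open>euler_path_increment\<close>
        still lies within distance \<open>d\<close> of \<open>t\<close>.\<close>
      have "\<bar>X y v - X t v - (y - t) * c\<bar> \<le> \<bar>y - t\<bar> * \<epsilon>" if y: "0 \<le> y" "\<bar>y - t\<bar> < d / 2" for y
      proof (rule tendsto_le[OF A(1)])
        have "((\<lambda>n. (\<bar>y - t\<bar> + h n) * \<epsilon> + h n * \<bar>c\<bar>) \<longlongrightarrow> (\<bar>y - t\<bar> + 0) * \<epsilon> + 0 * \<bar>c\<bar>) A"
          by (intro tendsto_intros hA)
        then show "((\<lambda>n. (\<bar>y - t\<bar> + h n) * \<epsilon> + h n * \<bar>c\<bar>) \<longlongrightarrow> \<bar>y - t\<bar> * \<epsilon>) A"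
          by simp
        show "((\<lambda>n. \<bar>P n y v - P n t v - (y - t) * c\<bar>) \<longlongrightarrow> \<bar>X y v - X t v - (y - t) * c\<bar>) A"
          by (intro tendsto_intros PX)
        have "\<forall>\<^sub>F n in A. h n < d / 2"
          by (rule order_tendstoD(2)[OF hA]) (use d(1) in simp)
        with Pa show "\<forall>\<^sub>F n in A. \<bar>P n y v - P n t v - (y - t) * c\<bar>
            \<le> (\<bar>y - t\<bar> + h n) * \<epsilon> + h n * \<bar>c\<bar>"
        proof eventually_elim
          case (elim n)
          have close: "\<bar>G v (P n s) - c\<bar> \<le> \<epsilon>" if "0 \<le> s" "\<bar>s - t\<bar> < d" for s
            using Pab[OF elim(1) d(2)[OF that(2,1)]] by simp
          show ?case
          proof (cases "t \<le> y")
            case True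
            have "\<bar>P n y v - P n t v - (y - t) * c\<bar> \<le> (y - t + h n) * \<epsilon> + h n * \<bar>c\<bar>"
              unfolding P_def using close elim y t True h[of n]
              by (intro euler_path_increment) (auto simp: P_def)
            then show ?thesis using True by simp
          next
            case False
            have "\<bar>P n t v - P n y v - (t - y) * c\<bar> \<le> (t - y + h n) * \<epsilon> + h n * \<bar>c\<bar>"
              unfolding P_def using close elim y t False h[of n]
              by (intro euler_path_increment) (auto simp: P_def)
            moreover have "P n t v - P n y v - (t - y) * c = - (P n y v - P n t v - (y - t) * c)"
              by (simp add: algebra_simps)
            ultimately show ?thesis using False by simp
          qed
        qed
      qed
      then show ?thesis
        using d(1) by (intro exI[of _ "d / 2"]) (auto simp: mult.commute)
    qed
    then show ?thesis
      unfolding has_field_derivative_def has_derivative_within_alt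
      by (auto simp: c_def bounded_linear_mult_right)
  qed
  ultimately show ?thesis by (rule that)
qed

section \<open>Spherical geometry of the quadrilateral of an edge\<close>

lemma gram_det_eq_0:
  fixes p q s d :: "real^3"
  assumes "d \<noteq> 0" "p \<bullet> d = 0" "q \<bullet> d = 0" "s \<bullet> d = 0"
  shows "(p \<bullet> p) * ((q \<bullet> q) * (s \<bullet> s) - (q \<bullet> s)\<^sup>2) - (p \<bullet> q) * ((p \<bullet> q) * (s \<bullet> s) - (q \<bullet> s) * (p \<bullet> s))
     + (p \<bullet> s) * ((p \<bullet> q) * (q \<bullet> s) - (q \<bullet> q) * (p \<bullet> s)) = 0"
proof -
  \<comment> \<open>\<open>D\<close> is the determinant of the matrix with rows \<open>p\<close>,
    \<open>q\<close>, \<open>s\<close>. This matrix annihilates \<open>d\<close>, so multiplying by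
    its adjugate gives \<open>D * d$i = 0\<close> for each coordinate. The Gram determinant in the
    claim is the square of \<open>D\<close>.\<close>
  define D where "D = p$1 * (q$2 * s$3 - q$3 * s$2) - p$2 * (q$1 * s$3 - q$3 * s$1) + p$3 * (q$1 * s$2 - q$2 * s$1)"
  have p: "p$1 * d$1 + p$2 * d$2 + p$3 * d$3 = 0" and q: "q$1 * d$1 + q$2 * d$2 + q$3 * d$3 = 0"
    and s: "s$1 * d$1 + s$2 * d$2 + s$3 * d$3 = 0"
    using assms by (simp_all add: inner_vec_def sum_3)
  have "D * d$1 = 0" "D * d$2 = 0" "D * d$3 = 0"
    unfolding D_def using p q s by algebra+
  moreover have "d$1 \<noteq> 0 \<or> d$2 \<noteq> 0 \<or> d$3 \<noteq> 0"
    using assms(1) by (auto simp: vec_eq_iff forall_3)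
  ultimately have "D = 0" by auto
  moreover have "(p \<bullet> p) * ((q \<bullet> q) * (s \<bullet> s) - (q \<bullet> s)\<^sup>2) - (p \<bullet> q) * ((p \<bullet> q) * (s \<bullet> s) - (q \<bullet> s) * (p \<bullet> s))
     + (p \<bullet> s) * ((p \<bullet> q) * (q \<bullet> s) - (q \<bullet> q) * (p \<bullet> s)) = D\<^sup>2"
    unfolding D_def inner_vec_def sum_3 inner_real_def by algebra
  ultimately show ?thesis by simp
qed

text \<open>Spherical law of cosines in the triangle \<open>P\<close>, \<open>A\<close>,
  \<open>Q\<close>; the angle at \<open>A\<close> is \<open>pi - \<theta>\<close>, hence the minus
  sign.\<close>

definition centre_dist_cos :: "real \<Rightarrow> real \<Rightarrow> real \<Rightarrow> real" where
  "centre_dist_cos ri rj \<theta> = cos ri * cos rj - sin ri * sin rj * cos \<theta>"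

text \<open>The inner fraction minus 1 is \<open>A \<bullet> B\<close>, as found from the Gram
  determinant; the rest is the law of cosines in the triangle \<open>A\<close>, \<open>P\<close>,
  \<open>B\<close>, whose sides at \<open>P\<close> both have length \<open>ri\<close>.\<close>

definition kite_angle_cos :: "real \<Rightarrow> real \<Rightarrow> real \<Rightarrow> real" where
  "kite_angle_cos ri rj \<theta> =
     (let a = cos ri; b = cos rj; c = centre_dist_cos ri rj \<theta>
      in (2 * (a\<^sup>2 + b\<^sup>2 - 2 * a * b * c) / (1 - c\<^sup>2) - 1 - a\<^sup>2) / (1 - a\<^sup>2))"

lemma sph_dist_eqD:
  assumes "P \<in> sphere 0 1" "A \<in> sphere 0 1" "sph_dist P A = r"
  shows "P \<bullet> A = cos r"
proof -
  have "\<bar>P \<bullet> A\<bar> \<le> 1"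
    using Cauchy_Schwarz_ineq2[of P A] assms by simp
  then show ?thesis
    using assms(3) by (auto simp: sph_dist_def cos_arccos_abs)
qed

lemma sph_tangent_inner:
  assumes "P \<in> sphere 0 1"
  shows "(A - (A \<bullet> P) *\<^sub>R P) \<bullet> (B - (B \<bullet> P) *\<^sub>R P) = A \<bullet> B - (A \<bullet> P) * (B \<bullet> P)"
  using assms by (simp add: inner_diff_left inner_diff_right inner_commute norm_eq_1)

lemma norm_sph_tangent:
  assumes "P \<in> sphere 0 1" "A \<in> sphere 0 1" "A \<bullet> P = cos r" "0 < r" "r < pi"
  shows "norm (A - (A \<bullet> P) *\<^sub>R P) = sin r"
proof -
  have "A \<bullet> A = 1" using assms(2) by (simp add: norm_eq_1)
  then have "norm (A - (A \<bullet> P) *\<^sub>R P) = sqrt (1 - (cos r)\<^sup>2)"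
    using sph_tangent_inner[OF assms(1), of A A] assms(3) by (simp add: norm_eq_sqrt_inner power2_eq_square)
  also have "\<dots> = sin r"
    using sin_gt_zero[OF assms(4,5)] by (simp add: sin_squared_eq[symmetric])
  finally show ?thesis .
qed

text \<open>The spherical law of cosines, solved for the angle. The bound, Cauchy-Schwarz for the
  tangent vectors, is what later allows \<open>cos\<close> to undo \<open>arccos\<close>.\<close>

lemma sph_angle_eq:
  assumes "P \<in> sphere 0 1" "A \<in> sphere 0 1" "B \<in> sphere 0 1"
    and "A \<bullet> P = cos r" "0 < r" "r < pi" "B \<bullet> P = cos r'" "0 < r'" "r' < pi"
  shows "sph_angle A P B = arccos ((A \<bullet> B - cos r * cos r') / (sin r * sin r'))"
    and "\<bar>(A \<bullet> B - cos r * cos r') / (sin r * sin r')\<bar> \<le> 1"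
proof -
  let ?u = "A - (A \<bullet> P) *\<^sub>R P" and ?w = "B - (B \<bullet> P) *\<^sub>R P"
  have n: "norm ?u = sin r" "norm ?w = sin r'"
    using assms by (intro norm_sph_tangent; simp)+
  have i: "?u \<bullet> ?w = A \<bullet> B - cos r * cos r'"
    using sph_tangent_inner[OF assms(1), of A B] assms by simp
  show "sph_angle A P B = arccos ((A \<bullet> B - cos r * cos r') / (sin r * sin r'))"
    unfolding sph_angle_def vec_angle_def i n ..
  have "\<bar>?u \<bullet> ?w\<bar> \<le> norm ?u * norm ?w"
    by (rule Cauchy_Schwarz_ineq2)
  then have "\<bar>A \<bullet> B - cos r * cos r'\<bar> \<le> sin r * sin r'"
    unfolding i n .
  moreover have "sin r * sin r' > 0"
    using assms by (simp add: sin_gt_zero)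
  ultimately show "\<bar>(A \<bullet> B - cos r * cos r') / (sin r * sin r')\<bar> \<le> 1"
    by (simp only: abs_divide abs_of_pos divide_le_eq_1_pos)
qed

text \<open>
  In the second inequality, the difference of the two sides is the Gram determinant of the unit
  vectors \<open>P\<close>, \<open>Q\<close>, \<open>A\<close> with \<open>P \<bullet> A = a\<close>, \<open>Q \<bullet> A = b\<close>, \<open>P \<bullet> Q = c\<close>; it is
  positive because they span a nondegenerate triangle.
\<close>

lemma kite_gram:
  assumes "c = centre_dist_cos ri rj \<theta>" "a = cos ri" "b = cos rj"
    and "0 < ri" "ri < pi" "0 < rj" "rj < pi" "0 < \<theta>" "\<theta> < pi"
  shows "c\<^sup>2 < 1" "(1 - a\<^sup>2) * (1 - c\<^sup>2) > (b - a * c)\<^sup>2"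
proof -
  have sq: "(sin ri)\<^sup>2 = 1 - a\<^sup>2" "(sin rj)\<^sup>2 = 1 - b\<^sup>2" "(sin \<theta>)\<^sup>2 = 1 - (cos \<theta>)\<^sup>2"
    using assms by (simp_all add: sin_squared_eq)
  have c: "c = a * b - sin ri * sin rj * cos \<theta>"
    using assms by (simp add: centre_dist_cos_def)
  have "(1 - a\<^sup>2) * (1 - c\<^sup>2) - (b - a * c)\<^sup>2 = (sin ri * sin rj * sin \<theta>)\<^sup>2"
    unfolding c using sq by algebra
  moreover have "sin ri * sin rj * sin \<theta> > 0"
    using assms by (simp add: sin_gt_zero)
  ultimately show *: "(1 - a\<^sup>2) * (1 - c\<^sup>2) > (b - a * c)\<^sup>2"
    by (smt (verit) zero_less_power2)
  then have "(1 - a\<^sup>2) * (1 - c\<^sup>2) > 0"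
    by (smt (verit) zero_le_power2)
  moreover have "1 - a\<^sup>2 > 0"
    using sin_gt_zero[OF assms(4,5)] sq(1) by (metis zero_less_power)
  ultimately show "c\<^sup>2 < 1"
    by (simp add: zero_less_mult_iff)
qed

text \<open>Uniqueness for the \<open>THE\<close> in \<open>quadrilateral_angle\<close>: the angle
  at \<open>A\<close> fixes \<open>P \<bullet> Q\<close>, the Gram determinant then fixes
  \<open>A \<bullet> B\<close>, and the law of cosines at \<open>P\<close> fixes the angle.\<close>

lemma edge_quadrilateral_angle:
  assumes quad: "edge_quadrilateral ri rj \<theta> P A Q B"
    and r: "0 < ri" "ri < pi" "0 < rj" "rj < pi" and \<theta>: "0 < \<theta>" "\<theta> < pi"
  shows "sph_angle A P B = arccos (kite_angle_cos ri rj \<theta>)" "\<bar>kite_angle_cos ri rj \<theta>\<bar> \<le> 1"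
proof -
  define a b c where "a = cos ri" and "b = cos rj" and "c = centre_dist_cos ri rj \<theta>"
  have sph: "P \<in> sphere 0 1" "A \<in> sphere 0 1" "Q \<in> sphere 0 1" "B \<in> sphere 0 1" and AB: "A \<noteq> B"
    using quad by (auto simp: edge_quadrilateral_def)
  have in1: "P \<bullet> A = a" "P \<bullet> B = a" "Q \<bullet> A = b" "Q \<bullet> B = b"
    unfolding a_def b_def using quad sph by (auto simp: edge_quadrilateral_def intro!: sph_dist_eqD)
  have nrm: "P \<bullet> P = 1" "A \<bullet> A = 1" "Q \<bullet> Q = 1" "B \<bullet> B = 1"
    using sph by (simp_all add: norm_eq_1)
  have "sph_angle P A Q = arccos ((P \<bullet> Q - a * b) / (sin ri * sin rj))"
    "\<bar>(P \<bullet> Q - a * b) / (sin ri * sin rj)\<bar> \<le> 1"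
    using sph_angle_eq[OF sph(2,1,3), of ri rj] in1 r unfolding a_def b_def by simp_all
  moreover have "sph_angle P A Q = pi - \<theta>"
    using quad by (simp add: edge_quadrilateral_def)
  ultimately have "(P \<bullet> Q - a * b) / (sin ri * sin rj) = cos (pi - \<theta>)"
    by (metis cos_arccos_abs)
  moreover have "sin ri > 0" "sin rj > 0"
    using r by (simp_all add: sin_gt_zero)
  ultimately have PQ: "P \<bullet> Q = c"
    by (simp add: c_def centre_dist_cos_def a_def b_def field_simps)
  have "(A + B) \<bullet> (A - B) = 0" "P \<bullet> (A - B) = 0" "Q \<bullet> (A - B) = 0"
    using in1 nrm by (simp_all add: inner_diff_right inner_diff_left inner_add_left inner_add_right inner_commute)
  with gram_det_eq_0[of "A - B" P Q "A + B"] AB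
  have "1 * ((1 * ((A + B) \<bullet> (A + B)) - (2 * b)\<^sup>2)) - c * (c * ((A + B) \<bullet> (A + B)) - (2 * b) * (2 * a))
      + (2 * a) * (c * (2 * b) - 1 * (2 * a)) = 0"
    by (simp add: in1 nrm PQ inner_add_right)
  moreover have "(A + B) \<bullet> (A + B) = 2 + 2 * (A \<bullet> B)"
    using nrm by (simp add: inner_add_left inner_add_right inner_commute)
  ultimately have "(1 + A \<bullet> B) * (1 - c\<^sup>2) = 2 * (a\<^sup>2 + b\<^sup>2 - 2 * a * b * c)"
    by algebra
  moreover have "c\<^sup>2 < 1"
    using kite_gram(1)[OF c_def a_def b_def r \<theta>] .
  ultimately have IAB: "A \<bullet> B = 2 * (a\<^sup>2 + b\<^sup>2 - 2 * a * b * c) / (1 - c\<^sup>2) - 1"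
    by (simp add: field_simps)
  have "sin ri * sin ri = 1 - a\<^sup>2"
    by (simp add: a_def sin_squared_eq flip: power2_eq_square)
  then have "(A \<bullet> B - cos ri * cos ri) / (sin ri * sin ri) = kite_angle_cos ri rj \<theta>"
    unfolding kite_angle_cos_def Let_def a_def[symmetric] b_def[symmetric] c_def[symmetric] IAB
    by (simp add: power2_eq_square)
  then show "sph_angle A P B = arccos (kite_angle_cos ri rj \<theta>)" "\<bar>kite_angle_cos ri rj \<theta>\<bar> \<le> 1"
    using sph_angle_eq[OF sph(1,2,4), of ri ri] in1 r by (simp_all add: a_def inner_commute)
qed

lemma edge_quadrilateral_exists:
  assumes r: "0 < ri" "ri < pi" "0 < rj" "rj < pi" and \<theta>: "0 < \<theta>" "\<theta> < pi"
  shows "\<exists>P A Q B. edge_quadrilateral ri rj \<theta> P A Q B"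
proof -
  define a b c where "a = cos ri" and "b = cos rj" and "c = centre_dist_cos ri rj \<theta>"
  note gram = kite_gram[OF c_def a_def b_def r \<theta>]
  \<comment> \<open>\<open>P\<close> goes on the first axis, \<open>Q\<close> in the plane of the
    first two axes, and \<open>A\<close>, \<open>B\<close> are mirror images in that plane.
    \<open>y\<close> solves \<open>c * a + w * y = b\<close>, that is
    \<open>Q \<bullet> A = b\<close>; \<open>w\<close> and \<open>z\<close> complete
    \<open>Q\<close> and \<open>A\<close> to unit length, and both are positive by
    \<open>kite_gram\<close>.\<close>
  define w where "w = sqrt (1 - c\<^sup>2)"
  have w: "w > 0" "w\<^sup>2 = 1 - c\<^sup>2" using gram by (simp_all add: w_def)
  define y where "y = (b - a * c) / w"
  have y: "y * w = b - a * c" "y\<^sup>2 < 1 - a\<^sup>2"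
    using w gram(2) using gram(1) by (simp_all add: y_def power_divide pos_divide_less_eq)
  define z where "z = sqrt (1 - a\<^sup>2 - y\<^sup>2)"
  have z: "z > 0" "z\<^sup>2 = 1 - a\<^sup>2 - y\<^sup>2" using y by (simp_all add: z_def)
  define P Q A B :: "real^3"
    where "P = vector [1, 0, 0]" and "Q = vector [c, w, 0]" and "A = vector [a, y, z]" and "B = vector [a, y, - z]"
  note defs = P_def Q_def A_def B_def
  have sph: "P \<in> sphere 0 1" "A \<in> sphere 0 1" "Q \<in> sphere 0 1" "B \<in> sphere 0 1"
    using w z by (simp_all add: norm_eq_1 inner_vec_def sum_3 defs flip: power2_eq_square)
  have inn: "P \<bullet> A = cos ri" "P \<bullet> B = cos ri" "Q \<bullet> A = cos rj" "Q \<bullet> B = cos rj" "P \<bullet> Q = c"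
    using y by (simp_all add: inner_vec_def sum_3 defs a_def b_def algebra_simps)
  have ne: "P \<noteq> A" "P \<noteq> B" "Q \<noteq> A" "Q \<noteq> B"
  proof -
    have "cos ri < cos 0" "cos rj < cos 0"
      using r by (intro cos_monotone_0_pi; simp)+
    then show "P \<noteq> A" "P \<noteq> B" "Q \<noteq> A" "Q \<noteq> B"
      using inn sph by (auto simp: norm_eq_1)
  qed
  moreover have "A \<noteq> B" "P \<noteq> Q"
    using z w by (auto simp: defs vec_eq_iff forall_3)
  moreover have dist: "sph_dist P A = ri" "sph_dist P B = ri" "sph_dist Q A = rj" "sph_dist Q B = rj"
    using inn r by (simp_all add: sph_dist_def arccos_cos)
  moreover have "sph_angle P X Q = pi - \<theta>" if "X = A \<or> X = B" for X
  proof -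
    have "sph_angle P X Q = arccos ((P \<bullet> Q - cos ri * cos rj) / (sin ri * sin rj))"
      using that sph inn r by (intro sph_angle_eq) auto
    also have "(P \<bullet> Q - cos ri * cos rj) / (sin ri * sin rj) = cos (pi - \<theta>)"
      using inn sin_gt_zero[OF r(1,2)] sin_gt_zero[OF r(3,4)]
      by (simp add: c_def centre_dist_cos_def field_simps)
    also have "arccos \<dots> = pi - \<theta>"
      using \<theta> by (intro arccos_cos) auto
    finally show ?thesis .
  qed
  ultimately have "edge_quadrilateral ri rj \<theta> P A Q B"
    using sph unfolding edge_quadrilateral_def by auto
  then show ?thesis by blast
qed

lemma quadrilateral_angle_eq:
  assumes "0 < ri" "ri < pi" "0 < rj" "rj < pi" "0 < \<theta>" "\<theta> < pi"
  shows "quadrilateral_angle ri rj \<theta> = arccos (kite_angle_cos ri rj \<theta>)"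
    and "\<bar>kite_angle_cos ri rj \<theta>\<bar> \<le> 1"
proof -
  obtain P A Q B where quad: "edge_quadrilateral ri rj \<theta> P A Q B"
    using edge_quadrilateral_exists[OF assms] by blast
  show "\<bar>kite_angle_cos ri rj \<theta>\<bar> \<le> 1"
    using edge_quadrilateral_angle(2)[OF quad assms] .
  show "quadrilateral_angle ri rj \<theta> = arccos (kite_angle_cos ri rj \<theta>)"
    unfolding quadrilateral_angle_def
    using quad edge_quadrilateral_angle(1)[OF _ assms] by (intro the_equality) metis+
qed

lemma quadrilateral_angle_bounds:
  assumes "0 < ri" "ri < pi" "0 < rj" "rj < pi" "0 < \<theta>" "\<theta> < pi"
  shows "0 \<le> quadrilateral_angle ri rj \<theta>" "quadrilateral_angle ri rj \<theta> \<le> pi"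
  using quadrilateral_angle_eq[OF assms] by (auto simp: abs_le_iff intro: arccos_lbound arccos_ubound)

text \<open>The denominators of \<open>kite_angle_cos\<close> are nonzero, one being the square of
  \<open>sin ri\<close> and the other handled by \<open>kite_gram\<close>. Its values stay in
  \<open>[-1, 1]\<close> because they are cosines of angles of actual quadrilaterals.\<close>

lemma continuous_on_quadrilateral_angle:
  assumes \<theta>: "0 < \<theta>" "\<theta> < pi"
  shows "continuous_on ({0<..<pi} \<times> {0<..<pi}) (\<lambda>(ri, rj). quadrilateral_angle ri rj \<theta>)"
proof -
  let ?X = "{0<..<pi} \<times> {0<..<pi} :: (real \<times> real) set"
  have "continuous_on ?X (\<lambda>p. arccos (kite_angle_cos (fst p) (snd p) \<theta>))"
  proof (rule continuous_on_arccos)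
    have ne: "1 - (cos (fst p))\<^sup>2 \<noteq> 0" "1 - (centre_dist_cos (fst p) (snd p) \<theta>)\<^sup>2 \<noteq> 0" if "p \<in> ?X" for p
    proof -
      have "(sin (fst p))\<^sup>2 > 0"
        using that sin_gt_zero[of "fst p"] by auto
      then show "1 - (cos (fst p))\<^sup>2 \<noteq> 0"
        by (simp add: sin_squared_eq)
      show "1 - (centre_dist_cos (fst p) (snd p) \<theta>)\<^sup>2 \<noteq> 0"
        using kite_gram(1)[OF refl refl refl, of "fst p" "snd p" \<theta>] that \<theta> by auto
    qed
    have c: "continuous_on ?X (\<lambda>p. centre_dist_cos (fst p) (snd p) \<theta>)"
      unfolding centre_dist_cos_def by (intro continuous_intros)
    show "continuous_on ?X (\<lambda>p. kite_angle_cos (fst p) (snd p) \<theta>)"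
      unfolding kite_angle_cos_def Let_def by (intro continuous_intros c ballI ne)
    show "\<forall>p\<in>?X. - 1 \<le> kite_angle_cos (fst p) (snd p) \<theta> \<and> kite_angle_cos (fst p) (snd p) \<theta> \<le> 1"
    proof
      fix p assume "p \<in> ?X"
      then have "\<bar>kite_angle_cos (fst p) (snd p) \<theta>\<bar> \<le> 1"
        using quadrilateral_angle_eq(2)[of "fst p" "snd p" \<theta>] \<theta> by auto
      then show "- 1 \<le> kite_angle_cos (fst p) (snd p) \<theta> \<and> kite_angle_cos (fst p) (snd p) \<theta> \<le> 1"
        by linarith
    qed
  qed
  then show ?thesis
    by (rule continuous_on_eq) (auto simp: quadrilateral_angle_eq(1) \<theta>)
qed

section \<open>Solving the flow in logarithmic coordinates\<close>

theorem theorem1p2: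
  fixes S :: "'a topology" and V :: "'a set" and E F :: "'a set set"
    and \<Theta> :: "'a set \<Rightarrow> real" and That :: "'a \<Rightarrow> real" and r0 :: "'a \<Rightarrow> real"
  assumes "surface S"
    and "cellular_decomposition S V E F"
    and "infinite V" and "countable V"
    and "locally_finite_decomposition S V E"
    and "intersection_angle E \<Theta>"
    and "\<And>v. v \<in> V \<Longrightarrow> That v > 0"
    and "\<And>U. U \<subseteq> V \<Longrightarrow> U \<noteq> {} \<Longrightarrow>
           (\<Sum>\<^sub>\<infinity>v\<in>U. ennreal (That v)) < 2 * (\<Sum>\<^sub>\<infinity>e\<in>edges_of S E U. ennreal (\<Theta> e))"
    and "circle_pattern_metric V r0"
  shows "\<exists>r :: real \<Rightarrow> 'a \<Rightarrow> real.
           (\<forall>v\<in>V. r 0 v = r0 v) \<and> flow_solution S V E \<Theta> That r"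
proof -
  \<comment> \<open>The inverse of the coordinate change, applied at every point of the type, so
    that all radii, including the one at \<open>other_end S e v\<close>, lie in
    \<open>(0, pi / 2)\<close>.\<close>
  define \<rho> :: "('a \<Rightarrow> real) \<Rightarrow> 'a \<Rightarrow> real" where "\<rho> x = (\<lambda>v. arctan (exp (x v)))" for x
  have \<rho>: "0 < \<rho> x v" "\<rho> x v < pi / 2" "\<rho> x v < pi" for x v
    using arctan_ubound[of "exp (x v)"] pi_gt_zero by (simp_all add: \<rho>_def del: pi_gt_zero)
  have cont_\<rho>: "continuous_on UNIV (\<lambda>x. \<rho> x v)" for v
    unfolding \<rho>_def by (intro continuous_intros) simp
  have \<Theta>: "0 < \<Theta> e" "\<Theta> e < pi" if "e \<in> edges_at S E v" for e v
    using that \<open>intersection_angle E \<Theta>\<close> pi_gt_zero by (fastforce simp: intersection_angle_def edges_at_def)+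
  define G where "G v x = total_geodesic_curvature S E \<Theta> (\<rho> x) v - That v" for v x
  have cont_G: "continuous_on UNIV (G v)" for v
  proof -
    have "continuous_on UNIV (\<lambda>x. angle_at S \<Theta> (\<rho> x) e v)" if "e \<in> edges_at S E v" for e
      using continuous_on_compose2[OF continuous_on_quadrilateral_angle[OF \<Theta>[OF that]]
          continuous_on_Pair[OF cont_\<rho>[of v] cont_\<rho>[of "other_end S e v"]]]
      by (simp add: \<rho> angle_at_def image_subset_iff)
    moreover have "continuous_on UNIV (\<lambda>x. cos (\<rho> x v))"
      by (rule continuous_on_compose2[of UNIV cos]) (auto intro: continuous_intros cont_\<rho>)
    ultimately show ?thesis
      unfolding G_def total_geodesic_curvature_def cone_angle_def
      by (intro continuous_on_diff continuous_on_mult continuous_on_sum continuous_on_const)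
  qed
  \<comment> \<open>The bound depends on \<open>v\<close> through the number of edges there; this is
    why \<open>peano_product\<close> takes a separate constant \<open>M v\<close> for each
    component.\<close>
  have bound_G: "\<bar>G v x\<bar> \<le> pi * card (edges_at S E v) + \<bar>That v\<bar>" for v x
  proof -
    have "\<bar>cone_angle S E \<Theta> (\<rho> x) v\<bar> \<le> (\<Sum>e\<in>edges_at S E v. \<bar>angle_at S \<Theta> (\<rho> x) e v\<bar>)"
      unfolding cone_angle_def by (rule sum_abs)
    also have "\<dots> \<le> (\<Sum>e\<in>edges_at S E v. pi)"
      using quadrilateral_angle_bounds by (intro sum_mono) (simp add: angle_at_def \<rho> \<Theta>)
    finally have "\<bar>cone_angle S E \<Theta> (\<rho> x) v\<bar> * \<bar>cos (\<rho> x v)\<bar> \<le> (pi * card (edges_at S E v)) * 1"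
      by (intro mult_mono) (auto simp: mult.commute)
    then show ?thesis
      unfolding G_def total_geodesic_curvature_def abs_mult[symmetric] by linarith
  qed
  obtain x where x0: "x 0 = (\<lambda>v. ln (tan (r0 v)))"
    and x: "\<And>v t. t \<ge> 0 \<Longrightarrow> ((\<lambda>s. x s v) has_real_derivative G v (x t)) (at t within {0..})"
    by (rule peano_product[of G, OF cont_G bound_G, of "\<lambda>v. ln (tan (r0 v))"]) blast
  \<comment> \<open>Off \<open>V\<close> the value \<open>r0 v\<close> is unconstrained and need not
    be recovered by \<open>\<rho>\<close>, so the claim is confined to \<open>V\<close>.\<close>
  have "\<rho> (x 0) v = r0 v" if "v \<in> V" for v
  proof -
    have "0 < r0 v" "r0 v < pi / 2"
      using that \<open>circle_pattern_metric V r0\<close> by (auto simp: circle_pattern_metric_def)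
    then show ?thesis
      by (simp add: \<rho>_def x0 tan_gt_zero arctan_tan)
  qed
  moreover have "flow_solution S V E \<Theta> That (\<lambda>t. \<rho> (x t))"
    unfolding flow_solution_def circle_pattern_metric_def
  proof (intro allI impI conjI ballI \<rho>)
    fix t v assume "0 \<le> (t::real)"
    let ?e = "exp (x t v)"
    have "((\<lambda>s. \<rho> (x s) v) has_real_derivative inverse (1 + ?e\<^sup>2) * (?e * G v (x t))) (at t within {0..})"
      unfolding \<rho>_def
      by (intro DERIV_chain2[OF DERIV_arctan] DERIV_chain2[OF DERIV_exp] x \<open>0 \<le> t\<close>)
    \<comment> \<open>In a right triangle with legs 1 and \<open>?e\<close> and hypotenuse
      \<open>q\<close>, the sine and cosine of \<open>\<rho> (x t) v\<close> are
      \<open>?e / q\<close> and \<open>1 / q\<close>. Their product is the derivative of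
      \<open>arctan\<close> after \<open>exp\<close>, which yields the factor of the flow.\<close>
    moreover have "inverse (1 + ?e\<^sup>2) * ?e = sin (2 * \<rho> (x t) v) / 2"
    proof -
      define q where "q = sqrt (1 + ?e\<^sup>2)"
      have "q * q = 1 + ?e\<^sup>2"
        unfolding q_def by (rule real_sqrt_mult_self[THEN trans]) simp
      moreover have "sin (2 * \<rho> (x t) v) = 2 * (?e / q) * (1 / q)"
        unfolding sin_double \<rho>_def sin_arctan cos_arctan q_def ..
      then have "sin (2 * \<rho> (x t) v) / 2 = ?e / (q * q)" by simp
      ultimately show ?thesis by (simp only: divide_inverse mult.commute)
    qed
    then have "inverse (1 + ?e\<^sup>2) * (?e * G v (x t)) = G v (x t) / 2 * sin (2 * \<rho> (x t) v)"
      by (simp only: mult.assoc[symmetric]) simp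
    ultimately show "((\<lambda>s. \<rho> (x s) v) has_real_derivative
        (total_geodesic_curvature S E \<Theta> (\<rho> (x t)) v - That v) / 2 * sin (2 * \<rho> (x t) v)) (at t within {0..})"
      by (simp only: G_def)
  qed
  ultimately show ?thesis
    by (intro exI[of _ "\<lambda>t. \<rho> (x t)"]) simp
qed

end
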